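(* Let $E_u$ be a Dedekind complete Riesz space with strong order unit $u$ and let $T$ be a conditional expectation on $E_u$ with $Tu=u$. If $f,g\in E_u$ are $T$-conditionally independent, then $\mathcal{M}_{f+g}=\mathcal{M}_f\,\mathcal{M}_g$, i.e. $\mathcal{M}_{f+g}(t)=\mathcal{M}_f(t)\,\mathcal{M}_g(t)$ for all $t\in\mathbb{R}$.
   Context: $E_u$ is a Dedekind complete Riesz space with strong order unit $u$. By the Yosida representation theorem there are a compact Hausdorff space $K$ and a Riesz isomorphism $\varphi:E_u\to C(K)$ with $\varphi(u)=1$; $E_u$ carries the $f$-algebra multiplication transported by $\varphi$, for which $u$ is the unit. The exponential is $\exp(x)=\varphi^{-1}(\exp\circ\varphi(x))=\sum_{k\ge0}x^k/k!$ (order limit, $x^0=u$). A conditional expectation $T$ is a positive order continuous linear projection mapping weak order units to weak order units whose range $R(T)$ is a Dedekind complete Riesz subspace. For $x\in E_u$ the moment generating function of $x$ is $\mathcal{M}_x:\mathbb{R}\to E_u$, $\mathcal{M}_x(t)=T(\exp(tx))$. Independence: band projections $P,Q$ are $T$-conditionally independent if $TPQu=TPu\cdot TQu$. Two Riesz subspaces $E_1,E_2$ are $T$-conditionally independent if all band projections $P_1,P_2$ with $P_iu\in E_i$ are $T$-conditionally independent. Elements $f,g$ are $T$-conditionally independent if the (order) closed Riesz subspaces $\langle f,R(T)\rangle$ and $\langle g,R(T)\rangle$ generated by $f$ and $R(T)$, respectively by $g$ and $R(T)$, are. *)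

theory Defs
  imports "HOL-Analysis.Analysis"
begin

class riesz_space = ordered_real_vector + lattice

text \<open>Dedekind completeness is existence of suprema and infima of nonempty order bounded sets;
  nothing is assumed about \<^term>\<open>Sup\<close> and \<^term>\<open>Inf\<close> on other sets.\<close>

class dedekind_complete_riesz_space = riesz_space + conditionally_complete_lattice

instance real :: dedekind_complete_riesz_space ..

definition modulus :: "'a::riesz_space \<Rightarrow> 'a" where
  "modulus x = sup x (- x)"

definition strong_order_unit :: "'a::riesz_space \<Rightarrow> bool" where
  "strong_order_unit u \<longleftrightarrow> 0 \<le> u \<and> (\<forall>x. \<exists>n::nat. modulus x \<le> real n *\<^sub>R u)"

definition weak_order_unit :: "'a::riesz_space \<Rightarrow> bool" where
  "weak_order_unit e \<longleftrightarrow> 0 \<le> e \<and> (\<forall>x. inf (modulus x) e = 0 \<longrightarrow> x = 0)"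

definition decreases_to_zero :: "'a::riesz_space set \<Rightarrow> bool" where
  "decreases_to_zero D \<longleftrightarrow> D \<noteq> {} \<and> (\<forall>a\<in>D. \<forall>b\<in>D. \<exists>c\<in>D. c \<le> a \<and> c \<le> b) \<and>
     (\<forall>d\<in>D. 0 \<le> d) \<and> (\<forall>b. (\<forall>d\<in>D. b \<le> d) \<longrightarrow> b \<le> 0)"

text \<open>Order convergence of nets, with a net represented by the filter on the space generated by
  its tails. Every proper filter arises from a net in this way.\<close>

definition order_converges :: "'a::riesz_space filter \<Rightarrow> 'a \<Rightarrow> bool" where
  "order_converges F l \<longleftrightarrow>
     (\<exists>D. decreases_to_zero D \<and> (\<forall>d\<in>D. eventually (\<lambda>x. modulus (x - l) \<le> d) F))"

definition order_continuous :: "('a::riesz_space \<Rightarrow> 'b::riesz_space) \<Rightarrow> bool" where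
  "order_continuous T \<longleftrightarrow>
     (\<forall>F l. order_converges F l \<longrightarrow> order_converges (filtermap T F) (T l))"

definition order_closed :: "'a::riesz_space set \<Rightarrow> bool" where
  "order_closed S \<longleftrightarrow>
     (\<forall>F l. F \<noteq> bot \<and> eventually (\<lambda>x. x \<in> S) F \<and> order_converges F l \<longrightarrow> l \<in> S)"

definition riesz_subspace :: "'a::riesz_space set \<Rightarrow> bool" where
  "riesz_subspace S \<longleftrightarrow> subspace S \<and> (\<forall>x\<in>S. \<forall>y\<in>S. sup x y \<in> S \<and> inf x y \<in> S)"

text \<open>Dedekind completeness of a subspace in its own right: suprema are taken within \<open>S\<close>.\<close>

definition dedekind_complete_on :: "'a::riesz_space set \<Rightarrow> bool" where
  "dedekind_complete_on S \<longleftrightarrow>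
     (\<forall>A. A \<subseteq> S \<and> A \<noteq> {} \<and> (\<exists>b\<in>S. \<forall>a\<in>A. a \<le> b) \<longrightarrow>
        (\<exists>s\<in>S. (\<forall>a\<in>A. a \<le> s) \<and> (\<forall>b\<in>S. (\<forall>a\<in>A. a \<le> b) \<longrightarrow> s \<le> b)))"

definition band :: "'a::riesz_space set \<Rightarrow> bool" where
  "band B \<longleftrightarrow> subspace B \<and> (\<forall>x y. y \<in> B \<and> modulus x \<le> modulus y \<longrightarrow> x \<in> B) \<and> order_closed B"

definition disjoint_complement :: "'a::riesz_space set \<Rightarrow> 'a set" where
  "disjoint_complement B = {x. \<forall>y\<in>B. inf (modulus x) (modulus y) = 0}"

text \<open>\<open>P x\<close> is the component of \<open>x\<close> in \<open>B\<close> for the decomposition of the whole space as the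
  direct sum of \<open>B\<close> and its disjoint complement.\<close>

definition band_projection :: "('a::riesz_space \<Rightarrow> 'a) \<Rightarrow> bool" where
  "band_projection P \<longleftrightarrow>
     (\<exists>B. band B \<and> (\<forall>x. P x \<in> B \<and> x - P x \<in> disjoint_complement B))"

text \<open>Elements of \<open>C(K)\<close> are represented as functions that are \<^term>\<open>undefined\<close> outside
  \<^term>\<open>topspace K\<close>.\<close>

definition continuous_functions :: "'k topology \<Rightarrow> ('k \<Rightarrow> real) set" where
  "continuous_functions K = {h \<in> extensional (topspace K). continuous_map K euclideanreal h}"

definition yosida_representation ::
    "'a::riesz_space \<Rightarrow> 'k topology \<Rightarrow> ('a \<Rightarrow> 'k \<Rightarrow> real) \<Rightarrow> bool" where
  "yosida_representation u K \<phi> \<longleftrightarrow>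
     compact_space K \<and> Hausdorff_space K \<and>
     bij_betw \<phi> UNIV (continuous_functions K) \<and>
     (\<forall>k\<in>topspace K.
        (\<forall>x y. \<phi> (x + y) k = \<phi> x k + \<phi> y k) \<and>
        (\<forall>c x. \<phi> (c *\<^sub>R x) k = c * \<phi> x k) \<and>
        (\<forall>x y. \<phi> (sup x y) k = max (\<phi> x k) (\<phi> y k)) \<and>
        (\<forall>x y. \<phi> (inf x y) k = min (\<phi> x k) (\<phi> y k)) \<and>
        \<phi> u k = 1)"

definition yosida_mult ::
    "'k topology \<Rightarrow> ('a \<Rightarrow> 'k \<Rightarrow> real) \<Rightarrow> 'a \<Rightarrow> 'a \<Rightarrow> 'a" where
  "yosida_mult K \<phi> x y = inv \<phi> (\<lambda>k\<in>topspace K. \<phi> x k * \<phi> y k)"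

definition yosida_exp :: "'k topology \<Rightarrow> ('a \<Rightarrow> 'k \<Rightarrow> real) \<Rightarrow> 'a \<Rightarrow> 'a" where
  "yosida_exp K \<phi> x = inv \<phi> (\<lambda>k\<in>topspace K. exp (\<phi> x k))"

definition conditional_expectation :: "('a::riesz_space \<Rightarrow> 'a) \<Rightarrow> bool" where
  "conditional_expectation T \<longleftrightarrow>
     linear T \<and> (\<forall>x\<ge>0. 0 \<le> T x) \<and> order_continuous T \<and> (\<forall>x. T (T x) = T x) \<and>
     (\<forall>e. weak_order_unit e \<longrightarrow> weak_order_unit (T e)) \<and>
     riesz_subspace (range T) \<and> dedekind_complete_on (range T)"

definition moment_generating_function ::
    "'k topology \<Rightarrow> ('a \<Rightarrow> 'k \<Rightarrow> real) \<Rightarrow> ('a \<Rightarrow> 'a) \<Rightarrow> 'a::riesz_space \<Rightarrow> real \<Rightarrow> 'a" where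
  "moment_generating_function K \<phi> T x t = T (yosida_exp K \<phi> (t *\<^sub>R x))"

definition cond_indep_projections ::
    "'k topology \<Rightarrow> ('a \<Rightarrow> 'k \<Rightarrow> real) \<Rightarrow> 'a \<Rightarrow> ('a \<Rightarrow> 'a) \<Rightarrow>
     ('a \<Rightarrow> 'a) \<Rightarrow> ('a \<Rightarrow> 'a) \<Rightarrow> bool" where
  "cond_indep_projections K \<phi> u T P Q \<longleftrightarrow>
     T (P (Q u)) = yosida_mult K \<phi> (T (P u)) (T (Q u))"

definition cond_indep_subspaces ::
    "'k topology \<Rightarrow> ('a::riesz_space \<Rightarrow> 'k \<Rightarrow> real) \<Rightarrow> 'a \<Rightarrow> ('a \<Rightarrow> 'a) \<Rightarrow>
     'a set \<Rightarrow> 'a set \<Rightarrow> bool" where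
  "cond_indep_subspaces K \<phi> u T E1 E2 \<longleftrightarrow>
     (\<forall>P Q. band_projection P \<and> band_projection Q \<and> P u \<in> E1 \<and> Q u \<in> E2 \<longrightarrow>
        cond_indep_projections K \<phi> u T P Q)"

definition closed_riesz_span :: "'a::riesz_space set \<Rightarrow> 'a set" where
  "closed_riesz_span A = (\<lambda>S. riesz_subspace S \<and> order_closed S) hull A"

definition cond_indep ::
    "'k topology \<Rightarrow> ('a::riesz_space \<Rightarrow> 'k \<Rightarrow> real) \<Rightarrow> 'a \<Rightarrow> ('a \<Rightarrow> 'a) \<Rightarrow>
     'a \<Rightarrow> 'a \<Rightarrow> bool" where
  "cond_indep K \<phi> u T f g \<longleftrightarrow>
     cond_indep_subspaces K \<phi> u T
       (closed_riesz_span (insert f (range T))) (closed_riesz_span (insert g (range T)))"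

end

theory Submission
  imports Defs
begin

text \<open>Fix an order closed Riesz subspace \<open>S\<close> containing \<open>u\<close>. For \<open>x \<in> S\<close> and \<open>c\<close> real, the component
  of \<open>u\<close> in the band generated by \<open>(x - c u)\<^sup>+\<close> is the supremum of \<open>inf (n (x - c u)\<^sup>+) u\<close>, so it
  lies in \<open>S\<close>. In \<open>C(K)\<close> it is an indicator function separating \<open>x > c\<close> from \<open>x < c\<close>. Since \<open>exp\<close> is
  increasing, the level sets of \<open>exp x\<close> are separated by the same components, and hence \<open>exp x\<close> is a
  uniform limit of linear combinations of components lying in \<open>S\<close>. For fixed \<open>q\<close> the elements \<open>h\<close>
  with \<open>T (h q) = T h \<cdot> T q\<close> form a uniformly closed linear subspace, because \<open>T\<close> is positive and
  \<open>T u = u\<close>. Independence gives this identity for components; it extends to \<open>exp (t f)\<close> in the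
  first argument and then to \<open>exp (t g)\<close> in the second.\<close>

section \<open>Order closed Riesz subspaces\<close>

lemma closed_riesz_span:
  shows riesz_subspace_closed_riesz_span: "riesz_subspace (closed_riesz_span A)"
    and order_closed_closed_riesz_span: "order_closed (closed_riesz_span A)"
proof -
  have "riesz_subspace (closed_riesz_span A) \<and> order_closed (closed_riesz_span A)"
    unfolding closed_riesz_span_def
  proof (rule hull_in)
    fix C :: "'a set set"
    assume C: "\<forall>S\<in>C. riesz_subspace S \<and> order_closed S"
    have "riesz_subspace (\<Inter>C)"
      using C by (auto simp: riesz_subspace_def intro!: subspace_Inter)
    moreover have "order_closed (\<Inter>C)"
      unfolding order_closed_def
    proof safe
      fix F :: "'a filter" and l S
      assume "F \<noteq> bot" "eventually (\<lambda>x. x \<in> \<Inter>C) F" "order_converges F l" "S \<in> C"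
      moreover from this have "eventually (\<lambda>x. x \<in> S) F"
        by (auto elim: eventually_mono)
      ultimately show "l \<in> S"
        using C unfolding order_closed_def by blast
    qed
    ultimately show "riesz_subspace (\<Inter>C) \<and> order_closed (\<Inter>C)" ..
  qed
  then show "riesz_subspace (closed_riesz_span A)" "order_closed (closed_riesz_span A)"
    by auto
qed

lemma closed_riesz_span_superset: "A \<subseteq> closed_riesz_span A"
  unfolding closed_riesz_span_def by (rule hull_subset)

lemma modulus_diff_le:
  fixes x y :: "'a::riesz_space"
  assumes "x \<le> y"
  shows "modulus (x - y) = y - x"
proof -
  have "x - y \<le> y - x"
    using assms by (meson diff_ge_0_iff_ge diff_le_0_iff_le order_trans)
  then show ?thesis
    by (simp add: modulus_def sup_absorb2)
qed

text \<open>An increasing sequence order converges to its supremum \<open>?s\<close>; the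
  differences \<open>?s - a n\<close> serve as the set decreasing to zero. This is how suprema are
  kept inside an order closed set.\<close>

lemma order_closed_Sup_incseq:
  fixes a :: "nat \<Rightarrow> 'a::dedekind_complete_riesz_space"
  assumes S: "order_closed S" and a: "\<And>n. a n \<in> S" and "incseq a" "bdd_above (range a)"
  shows "Sup (range a) \<in> S"
proof -
  let ?s = "Sup (range a)"
  have upper: "a n \<le> ?s" for n
    using assms(4) by (simp add: cSUP_upper)
  have "decreases_to_zero (range (\<lambda>n. ?s - a n))"
    unfolding decreases_to_zero_def
  proof (intro conjI ballI allI impI)
    fix x y assume "x \<in> range (\<lambda>n. ?s - a n)" "y \<in> range (\<lambda>n. ?s - a n)"
    then obtain m n where "x = ?s - a m" "y = ?s - a n" by auto
    moreover have "a m \<le> a (max m n)" "a n \<le> a (max m n)"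
      using \<open>incseq a\<close> by (simp_all add: incseq_def)
    ultimately show "\<exists>z\<in>range (\<lambda>n. ?s - a n). z \<le> x \<and> z \<le> y"
      by (auto intro!: bexI[of _ "?s - a (max m n)"])
  next
    fix b assume "\<forall>d\<in>range (\<lambda>n. ?s - a n). b \<le> d"
    then have "a n \<le> ?s - b" for n
      by (auto simp: algebra_simps)
    then have "?s \<le> ?s - b"
      by (intro cSUP_least) auto
    then show "b \<le> 0" by simp
  qed (use upper in auto)
  moreover have "eventually (\<lambda>m. modulus (a m - ?s) \<le> ?s - a n) sequentially" for n
    using eventually_ge_at_top[of n]
    by eventually_elim (use \<open>incseq a\<close> upper in \<open>simp add: modulus_diff_le incseq_def\<close>)
  ultimately have "order_converges (filtermap a sequentially) ?s"
    unfolding order_converges_def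
    by (intro exI[of _ "range (\<lambda>n. ?s - a n)"]) (auto simp: eventually_filtermap)
  moreover have "filtermap a sequentially \<noteq> bot"
    by (simp add: filtermap_bot_iff)
  moreover have "eventually (\<lambda>x. x \<in> S) (filtermap a sequentially)"
    using a by (simp add: eventually_filtermap)
  ultimately show ?thesis
    using S unfolding order_closed_def by blast
qed

section \<open>Pointwise calculus through the representation in \<open>C(K)\<close>\<close>

locale yosida_space =
  fixes u :: "'a::riesz_space" and K :: "'k topology" and \<phi> :: "'a \<Rightarrow> 'k \<Rightarrow> real"
  assumes representation: "yosida_representation u K \<phi>"
begin

abbreviation mult :: "'a \<Rightarrow> 'a \<Rightarrow> 'a" (infixl "\<odot>" 70) where
  "x \<odot> y \<equiv> yosida_mult K \<phi> x y"

lemma bij: "bij_betw \<phi> UNIV (continuous_functions K)"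
  using representation by (simp add: yosida_representation_def)

lemma
  assumes "k \<in> topspace K"
  shows phi_add: "\<phi> (x + y) k = \<phi> x k + \<phi> y k"
    and phi_scale: "\<phi> (c *\<^sub>R x) k = c * \<phi> x k"
    and phi_sup: "\<phi> (sup x y) k = max (\<phi> x k) (\<phi> y k)"
    and phi_inf: "\<phi> (inf x y) k = min (\<phi> x k) (\<phi> y k)"
    and phi_unit: "\<phi> u k = 1"
  using representation assms by (auto simp: yosida_representation_def)

lemma phi_zero: "k \<in> topspace K \<Longrightarrow> \<phi> 0 k = 0"
  using phi_scale[of k 0 0] by simp

lemma phi_minus: "k \<in> topspace K \<Longrightarrow> \<phi> (- x) k = - \<phi> x k"
  using phi_scale[of k "-1" x] by simp

lemma phi_diff: "k \<in> topspace K \<Longrightarrow> \<phi> (x - y) k = \<phi> x k - \<phi> y k"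
  using phi_add[of k x "- y"] by (simp add: phi_minus)

lemma phi_modulus: "k \<in> topspace K \<Longrightarrow> \<phi> (modulus x) k = \<bar>\<phi> x k\<bar>"
  by (simp add: modulus_def phi_sup phi_minus abs_real_def max_def)

lemmas phi_simps =
  phi_add phi_scale phi_sup phi_inf phi_unit phi_zero phi_minus phi_diff phi_modulus

lemma phi_continuous: "\<phi> x \<in> continuous_functions K"
  using bij by (auto simp: bij_betw_def)

lemma phi_continuous_map: "continuous_map K euclideanreal (\<phi> x)"
  using phi_continuous[of x] by (simp add: continuous_functions_def)

lemma phi_eqI:
  assumes "\<And>k. k \<in> topspace K \<Longrightarrow> \<phi> x k = \<phi> y k"
  shows "x = y"
proof -
  have "\<phi> x = \<phi> y"
    using phi_continuous[of x] phi_continuous[of y] assms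
    by (intro extensionalityI[of _ "topspace K"]) (auto simp: continuous_functions_def)
  then show ?thesis
    using bij by (auto simp: bij_betw_def dest: injD)
qed

text \<open>The representation speaks only of lattice operations; the order is recovered from them,
  since \<open>x\<close> lies below \<open>y\<close> exactly when
  \<open>sup x y = y\<close>.\<close>

lemma phi_le_iff: "x \<le> y \<longleftrightarrow> (\<forall>k\<in>topspace K. \<phi> x k \<le> \<phi> y k)"
proof
  assume "x \<le> y"
  then have "sup x y = y" by (simp add: sup_absorb2)
  then show "\<forall>k\<in>topspace K. \<phi> x k \<le> \<phi> y k"
    by (metis phi_sup max.cobounded1)
next
  assume *: "\<forall>k\<in>topspace K. \<phi> x k \<le> \<phi> y k"
  have "sup x y = y"
    by (rule phi_eqI) (use * in \<open>simp add: phi_sup\<close>)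
  then show "x \<le> y" by (metis sup_ge1)
qed

lemma phi_inv:
  assumes "continuous_map K euclideanreal h" "k \<in> topspace K"
  shows "\<phi> (inv \<phi> (restrict h (topspace K))) k = h k"
proof -
  have "continuous_map K euclideanreal (restrict h (topspace K))"
    by (rule continuous_map_eq[OF assms(1)]) simp
  then have "restrict h (topspace K) \<in> range \<phi>"
    using bij by (auto simp: bij_betw_def continuous_functions_def)
  then show ?thesis
    using assms(2) by (simp add: f_inv_into_f)
qed

lemma phi_mult: "k \<in> topspace K \<Longrightarrow> \<phi> (x \<odot> y) k = \<phi> x k * \<phi> y k"
  unfolding yosida_mult_def
  by (rule phi_inv) (intro continuous_map_real_mult phi_continuous_map)

lemma phi_exp:
  assumes "k \<in> topspace K"
  shows "\<phi> (yosida_exp K \<phi> x) k = exp (\<phi> x k)"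
proof -
  have "continuous_map K euclideanreal (exp \<circ> \<phi> x)"
    by (rule continuous_map_compose[OF phi_continuous_map]) (simp add: continuous_on_exp)
  then show ?thesis
    unfolding yosida_exp_def using assms phi_inv[of "\<lambda>k. exp (\<phi> x k)" k] by (simp add: o_def)
qed

lemma mult_commute: "x \<odot> y = y \<odot> x"
  by (simp add: yosida_mult_def mult.commute)

lemma exp_add: "yosida_exp K \<phi> (x + y) = yosida_exp K \<phi> x \<odot> yosida_exp K \<phi> y"
  by (rule phi_eqI) (simp add: phi_simps phi_exp phi_mult Transcendental.exp_add)

lemma phi_bounded:
  assumes "strong_order_unit u"
  obtains M where "0 \<le> M" "\<And>k. k \<in> topspace K \<Longrightarrow> \<bar>\<phi> x k\<bar> \<le> M"
proof -
  obtain n :: nat where "modulus x \<le> real n *\<^sub>R u"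
    using assms by (auto simp: strong_order_unit_def)
  then show thesis
    by (intro that[of "real n"]) (auto simp: phi_le_iff phi_simps)
qed

section \<open>Components of \<open>u\<close> (indicators of clopen sets) and their band
  projections\<close>

definition component :: "'a \<Rightarrow> bool" where
  "component p \<longleftrightarrow> (\<forall>k\<in>topspace K. \<phi> p k = 0 \<or> \<phi> p k = 1)"

lemma component_unit: "component u"
  by (simp add: component_def phi_unit)

text \<open>Multiplying by a 0-1 function splits \<open>x\<close> into a part living where
  \<open>p = 1\<close> and a part living where \<open>p = 0\<close>. The band is therefore the set
  of elements vanishing wherever \<open>p\<close> does.\<close>

lemma band_projection_component:
  assumes p: "component p"
  shows "band_projection (\<lambda>x. p \<odot> x)"
proof -
  define B where "B = {y. \<forall>k\<in>topspace K. \<phi> p k = 0 \<longrightarrow> \<phi> y k = 0}"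
  have "order_closed B"
    unfolding order_closed_def
  proof (intro allI impI)
    fix F :: "'a filter" and l
    assume F: "F \<noteq> bot \<and> eventually (\<lambda>x. x \<in> B) F \<and> order_converges F l"
    then obtain D where D: "decreases_to_zero D"
      and ev: "\<And>d. d \<in> D \<Longrightarrow> eventually (\<lambda>x. modulus (x - l) \<le> d) F"
      by (auto simp: order_converges_def)
    \<comment> \<open>Order convergence need not be pointwise, so the limit is tested globally. The
      factor \<open>u - p\<close> restricts to the zero set of \<open>p\<close>, where
      \<open>x\<close> in \<open>B\<close> vanishes and \<open>modulus (x - l)\<close> reduces to
      \<open>modulus l\<close>.\<close>
    have "modulus ((u - p) \<odot> l) \<le> d" if d: "d \<in> D" for d
    proof -
      have "eventually (\<lambda>x. x \<in> B \<and> modulus (x - l) \<le> d) F"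
        using F ev[OF d] by (auto intro: eventually_conj)
      then obtain x where x: "x \<in> B" "modulus (x - l) \<le> d"
        using F eventually_happens'[of F] by blast
      show ?thesis
        unfolding phi_le_iff
      proof
        fix k assume k: "k \<in> topspace K"
        have "\<bar>\<phi> x k - \<phi> l k\<bar> \<le> \<phi> d k"
          using x(2) k by (simp add: phi_le_iff phi_simps)
        then show "\<phi> (modulus ((u - p) \<odot> l)) k \<le> \<phi> d k"
          using x(1) p k by (force simp: B_def component_def phi_simps phi_mult)
      qed
    qed
    then have "modulus ((u - p) \<odot> l) \<le> 0"
      using D by (auto simp: decreases_to_zero_def)
    then show "l \<in> B"
      by (auto simp: B_def phi_le_iff phi_simps phi_mult)
  qed
  moreover have "subspace B"
    by (auto simp: subspace_def B_def phi_simps)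
  moreover have "x \<in> B" if "y \<in> B" "modulus x \<le> modulus y" for x y
    using that by (fastforce simp: B_def phi_le_iff phi_simps)
  ultimately have "band B"
    by (auto simp: band_def)
  moreover have "p \<odot> x \<in> B" for x
    by (simp add: B_def phi_mult)
  moreover have "x - p \<odot> x \<in> disjoint_complement B" for x
    unfolding disjoint_complement_def
  proof safe
    fix y assume "y \<in> B"
    then show "inf (modulus (x - p \<odot> x)) (modulus y) = 0"
      using p by (intro phi_eqI) (force simp: B_def component_def phi_simps phi_mult)
  qed
  ultimately show ?thesis
    unfolding band_projection_def by blast
qed

lemma cond_indep_components:
  assumes "cond_indep_subspaces K \<phi> u T E1 E2"
    and "component p" "p \<in> E1" "component q" "q \<in> E2"
  shows "T (p \<odot> q) = T p \<odot> T q"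
proof -
  have unit: "r \<odot> u = r" for r
    by (rule phi_eqI) (simp add: phi_mult phi_unit)
  have "cond_indep_projections K \<phi> u T (\<lambda>x. p \<odot> x) (\<lambda>x. q \<odot> x)"
    using assms band_projection_component unfolding cond_indep_subspaces_def by (simp add: unit)
  then show ?thesis
    by (simp add: cond_indep_projections_def unit)
qed

section \<open>Uniform approximation by components\<close>

text \<open>At points where \<open>y\<close> equals \<open>c\<close> either value is allowed: the
  indicator of \<open>y > c\<close> itself need not be continuous.\<close>

definition separates_level :: "'a \<Rightarrow> 'a \<Rightarrow> real \<Rightarrow> bool" where
  "separates_level p y c \<longleftrightarrow> component p \<and>
     (\<forall>k\<in>topspace K. (c < \<phi> y k \<longrightarrow> \<phi> p k = 1) \<and> (\<phi> y k < c \<longrightarrow> \<phi> p k = 0))"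

text \<open>Layer-cake sum: each level \<open>i * \<epsilon>\<close> reached by \<open>y\<close>
  contributes one layer of height \<open>\<epsilon>\<close>, so the error is at most one
  layer.\<close>

lemma approximation_by_components:
  assumes y: "\<And>k. k \<in> topspace K \<Longrightarrow> 0 \<le> \<phi> y k \<and> \<phi> y k \<le> M"
    and sep: "\<And>c. \<exists>p\<in>S. separates_level p y c"
    and "0 < \<epsilon>"
  obtains s where "s \<in> span {p \<in> S. component p}" "\<And>k. k \<in> topspace K \<Longrightarrow> \<bar>\<phi> y k - \<phi> s k\<bar> \<le> \<epsilon>"
proof -
  obtain p where p: "\<And>c. p c \<in> S" "\<And>c. separates_level (p c) y c"
    using sep by metis
  define s where "s n = (\<Sum>i = 1..n. \<epsilon> *\<^sub>R p (real i * \<epsilon>))" for n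
  have s_span: "s n \<in> span {p \<in> S. component p}" for n
    unfolding s_def using p
    by (intro span_sum span_scale span_base) (auto simp: separates_level_def)
  \<comment> \<open>The last conjunct carries the induction: when \<open>y\<close> exceeds level
    \<open>n\<close>, all \<open>n\<close> layers are already counted. This yields the lower bound
    if the next layer is absent.\<close>
  have bounds: "\<phi> (s n) k \<le> min (\<phi> y k) (real n * \<epsilon>) \<and> min (\<phi> y k) (real n * \<epsilon>) - \<epsilon> \<le> \<phi> (s n) k
      \<and> (real n * \<epsilon> < \<phi> y k \<longrightarrow> \<phi> (s n) k = real n * \<epsilon>)" if k: "k \<in> topspace K" for k n
  proof (induction n)
    case 0
    then show ?case
      using y[OF k] k \<open>0 < \<epsilon>\<close> by (auto simp: s_def phi_zero)
  next
    case (Suc n)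
    let ?p = "\<phi> (p (real (Suc n) * \<epsilon>)) k"
    have step: "\<phi> (s (Suc n)) k = \<phi> (s n) k + \<epsilon> * ?p"
      using k by (simp add: s_def phi_simps)
    have mult_Suc: "real (Suc n) * \<epsilon> = real n * \<epsilon> + \<epsilon>"
      by (simp add: algebra_simps)
    have "?p = 0 \<or> ?p = 1" "real (Suc n) * \<epsilon> < \<phi> y k \<longrightarrow> ?p = 1" "\<phi> y k < real (Suc n) * \<epsilon> \<longrightarrow> ?p = 0"
      using p(2)[of "real (Suc n) * \<epsilon>"] k by (auto simp: separates_level_def component_def)
    then show ?case
      using Suc.IH \<open>0 < \<epsilon>\<close> unfolding step mult_Suc by (auto simp: min_def split: if_splits)
  qed
  \<comment> \<open>Enough layers to reach the top of \<open>y\<close>, so that the truncation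
    \<open>min\<close> in \<open>bounds\<close> disappears.\<close>
  obtain n :: nat where n: "M / \<epsilon> \<le> real n"
    using real_arch_simple by blast
  have "\<bar>\<phi> y k - \<phi> (s n) k\<bar> \<le> \<epsilon>" if k: "k \<in> topspace K" for k
  proof -
    have "\<phi> y k \<le> real n * \<epsilon>"
      using n y[OF k] \<open>0 < \<epsilon>\<close> by (simp add: field_simps)
    then show ?thesis
      using bounds[OF k, of n] by (simp add: min_def)
  qed
  then show thesis
    using that s_span by blast
qed

lemma separates_level_exp:
  assumes "\<And>c. \<exists>p\<in>S. separates_level p x c" and "u \<in> S"
  shows "\<exists>p\<in>S. separates_level p (yosida_exp K \<phi> x) c"
proof (cases "0 < c")
  case True
  obtain p where "p \<in> S" "separates_level p x (ln c)"
    using assms(1) by blast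
  \<comment> \<open>Keeping the level in the form \<open>exp (ln c)\<close> lets monotonicity of
    \<open>exp\<close> compare the exponents.\<close>
  moreover from this True have "separates_level p (yosida_exp K \<phi> x) (exp (ln c))"
    unfolding separates_level_def by (simp add: phi_exp del: exp_ln)
  ultimately show ?thesis
    using True by auto
next
  case False
  \<comment> \<open>The exponential is positive, hence above every level \<open>c\<close> that is
    not positive, and the constant 1 separates.\<close>
  then have "separates_level u (yosida_exp K \<phi> x) c"
    using component_unit by (auto simp: separates_level_def phi_exp phi_unit dest: less_le_trans)
      (metis exp_gt_zero less_trans)
  then show ?thesis
    using \<open>u \<in> S\<close> by blast
qed

section \<open>Extending multiplicativity of \<open>T\<close> to uniform limits\<close>

lemma positive_operator_bound:
  assumes T: "linear T" "\<forall>x\<ge>0. 0 \<le> T x" "T u = u"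
    and x: "\<And>k. k \<in> topspace K \<Longrightarrow> \<bar>\<phi> x k\<bar> \<le> c"
    and k: "k \<in> topspace K"
  shows "\<bar>\<phi> (T x) k\<bar> \<le> c"
proof -
  \<comment> \<open>Positivity is applied to the two halves of the bound of \<open>x\<close> by
    \<open>c\<close> times \<open>u\<close>; as \<open>T u = u\<close>, the same bound returns for
    \<open>T x\<close>.\<close>
  have "0 \<le> T (c *\<^sub>R u - x)" "0 \<le> T (c *\<^sub>R u + x)"
    using x by (force simp: phi_le_iff phi_simps intro!: T(2)[rule_format])+
  then have "0 \<le> \<phi> (T (c *\<^sub>R u - x)) k" "0 \<le> \<phi> (T (c *\<^sub>R u + x)) k"
    using k by (auto simp: phi_le_iff phi_zero)
  then show ?thesis
    using k by (simp add: linear_diff[OF T(1)] linear_add[OF T(1)] linear_scale[OF T(1)] T(3) phi_simps)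
qed

text \<open>Both sides are linear in the first factor, and both change by at most
  \<open>\<epsilon> * M\<close> when that factor changes uniformly by \<open>\<epsilon>\<close>,
  where \<open>M\<close> bounds \<open>q\<close>.\<close>

lemma multiplicative_extension:
  assumes "strong_order_unit u"
    and T: "linear T" "\<forall>x\<ge>0. 0 \<le> T x" "T u = u"
    and base: "\<And>p. p \<in> C \<Longrightarrow> T (p \<odot> q) = T p \<odot> T q"
    and approx: "\<And>\<epsilon>. 0 < \<epsilon> \<Longrightarrow> \<exists>s\<in>span C. \<forall>k\<in>topspace K. \<bar>\<phi> y k - \<phi> s k\<bar> \<le> \<epsilon>"
  shows "T (y \<odot> q) = T y \<odot> T q"
proof (rule phi_eqI)
  fix k assume k: "k \<in> topspace K"
  have mult_add: "(x + z) \<odot> w = x \<odot> w + z \<odot> w" for x z w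
    by (rule phi_eqI) (simp add: phi_simps phi_mult algebra_simps)
  have mult_scale: "(c *\<^sub>R x) \<odot> w = c *\<^sub>R (x \<odot> w)" for c x w
    by (rule phi_eqI) (simp add: phi_simps phi_mult)
  have span: "T (s \<odot> q) = T s \<odot> T q" if "s \<in> span C" for s
    using that
  proof (induction rule: span_induct_alt)
    case base
    have "0 \<odot> w = 0" for w
      by (rule phi_eqI) (simp add: phi_simps phi_mult)
    then show ?case
      by (simp add: linear_0[OF T(1)])
  next
    case (step c x z)
    then show ?case
      using base by (simp add: mult_add mult_scale linear_add[OF T(1)] linear_scale[OF T(1)])
  qed
  obtain M where "0 \<le> M" and M: "\<And>k. k \<in> topspace K \<Longrightarrow> \<bar>\<phi> q k\<bar> \<le> M"
    using phi_bounded[OF assms(1), of q] by blast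
  note bound = positive_operator_bound[OF T]
  have est: "\<bar>\<phi> (T (y \<odot> q)) k - \<phi> (T y \<odot> T q) k\<bar> \<le> 2 * (\<epsilon> * M)" if \<epsilon>: "0 < \<epsilon>" for \<epsilon>
  proof -
    obtain s where "s \<in> span C" and s: "\<And>k. k \<in> topspace K \<Longrightarrow> \<bar>\<phi> (y - s) k\<bar> \<le> \<epsilon>"
      using approx[OF \<epsilon>] by (auto simp: phi_simps)
    have "\<bar>\<phi> ((y - s) \<odot> q) k\<bar> \<le> \<epsilon> * M" if "k \<in> topspace K" for k
      using mult_mono[OF s[OF that] M[OF that]] that \<open>0 < \<epsilon>\<close> by (simp add: phi_mult abs_mult)
    then have 1: "\<bar>\<phi> (T ((y - s) \<odot> q)) k\<bar> \<le> \<epsilon> * M"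
      using bound k by blast
    have 2: "\<bar>\<phi> (T (y - s) \<odot> T q) k\<bar> \<le> \<epsilon> * M"
      using mult_mono[OF bound[OF s k] bound[OF M k]] k \<open>0 < \<epsilon>\<close> by (simp add: phi_mult abs_mult)
    have "T (y \<odot> q) = T ((y - s) \<odot> q) + T (s \<odot> q)" "T y = T (y - s) + T s"
      by (simp_all add: mult_add[symmetric] linear_add[OF T(1), symmetric])
    then have "T (y \<odot> q) - T y \<odot> T q = T ((y - s) \<odot> q) - T (y - s) \<odot> T q"
      by (simp add: span[OF \<open>s \<in> span C\<close>] mult_add)
    then have "\<phi> (T (y \<odot> q)) k - \<phi> (T y \<odot> T q) k
        = \<phi> (T ((y - s) \<odot> q)) k - \<phi> (T (y - s) \<odot> T q) k"
      using k by (metis phi_diff)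
    then show ?thesis
      using 1 2 by linarith
  qed
  show "\<phi> (T (y \<odot> q)) k = \<phi> (T y \<odot> T q) k"
  proof (rule ccontr)
    let ?d = "\<bar>\<phi> (T (y \<odot> q)) k - \<phi> (T y \<odot> T q) k\<bar>"
    assume "\<not> ?thesis"
    then have "0 < ?d" by simp
    \<comment> \<open>This choice of \<open>\<epsilon>\<close> makes the error at most half of
      \<open>?d\<close>; \<open>M + 1\<close> keeps the denominator positive even for
      \<open>M = 0\<close>.\<close>
    moreover from this have "?d \<le> 2 * (?d / (4 * (M + 1)) * M)"
      using \<open>0 \<le> M\<close> by (intro est) simp
    then have "?d * (2 * M + 4) \<le> 0"
      using \<open>0 \<le> M\<close> by (simp add: field_simps)
    ultimately show False
      using \<open>0 \<le> M\<close> by (simp add: mult_le_0_iff)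
  qed
qed

end

section \<open>Components inside an order closed Riesz subspace\<close>

locale dedekind_complete_yosida_space = yosida_space u K \<phi>
  for u :: "'a::dedekind_complete_riesz_space" and K :: "'k topology" and \<phi>
begin

text \<open>The supremum \<open>p\<close> need not be pointwise, so upper bounds on its values come
  from leastness: an element built from \<open>p\<close> by lattice operations that dominates every
  \<open>a n\<close> also dominates \<open>p\<close>.\<close>

lemma ex_separates_level:
  assumes S: "riesz_subspace S" "order_closed S" and "u \<in> S" "x \<in> S"
  shows "\<exists>p\<in>S. separates_level p x c"
proof -
  define y z where "y = sup (x - c *\<^sub>R u) 0" and "z = sup (c *\<^sub>R u - x) 0"
  define a where "a n = inf (real n *\<^sub>R y) u" for n
  define p where "p = Sup (range a)"
  have sub: "subspace S"
    using S(1) by (simp add: riesz_subspace_def)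
  have "a n \<in> S" for n
    using S(1) \<open>u \<in> S\<close> \<open>x \<in> S\<close> subspace_0[OF sub] unfolding a_def y_def riesz_subspace_def
    by (simp add: subspace_scale subspace_diff)
  moreover have "incseq a"
    unfolding incseq_def a_def
    by (auto simp: phi_le_iff phi_simps y_def simp del: min.bounded_iff
        intro!: min.mono mult_right_mono)
  moreover have bdd: "bdd_above (range a)"
    by (rule bdd_aboveI[of _ u]) (auto simp: a_def)
  ultimately have "p \<in> S"
    unfolding p_def using S(2) by (intro order_closed_Sup_incseq)
  have upper: "a n \<le> p" for n
    unfolding p_def using bdd by (simp add: cSUP_upper)
  have least: "p \<le> b" if "\<And>n. a n \<le> b" for b
    unfolding p_def using that by (intro cSUP_least) auto
  have a_phi: "\<phi> (a n) k = min (real n * max (\<phi> x k - c) 0) 1" if "k \<in> topspace K" for n k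
    using that by (simp add: a_def y_def phi_simps)
  have upper_phi: "\<phi> (a n) k \<le> \<phi> p k" if "k \<in> topspace K" for n k
    using upper[of n] that by (simp add: phi_le_iff)
  have p_nonneg: "0 \<le> \<phi> p k" if "k \<in> topspace K" for k
    using upper_phi[OF that, of 0] that by (simp add: a_phi)
  have p_le_1: "\<phi> p k \<le> 1" if "k \<in> topspace K" for k
    using least[of u] that by (simp add: a_def phi_le_iff phi_simps)
  \<comment> \<open>Where \<open>p < 1\<close>, the bound \<open>a (2 * n) \<le> p\<close> gives \<open>a n \<le> p / 2\<close>; so \<open>p\<close> cannot take values
    strictly between 0 and 1.\<close>
  have "p \<le> sup ((1/2) *\<^sub>R p) (2 *\<^sub>R p - u)"
  proof (rule least)
    fix n
    show "a n \<le> sup ((1/2) *\<^sub>R p) (2 *\<^sub>R p - u)"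
      unfolding phi_le_iff
    proof
      fix k assume k: "k \<in> topspace K"
      define r where "r = real n * max (\<phi> x k - c) 0"
      have "min (2 * r) 1 \<le> \<phi> p k"
        using upper_phi[OF k, of "2 * n"] k by (simp add: a_phi r_def mult.assoc)
      then have "min r 1 \<le> max (\<phi> p k / 2) (2 * \<phi> p k - 1)"
        using p_le_1[OF k] by (auto simp: min_def max_def split: if_splits)
      then show "\<phi> (a n) k \<le> \<phi> (sup ((1/2) *\<^sub>R p) (2 *\<^sub>R p - u)) k"
        using k by (simp add: a_phi r_def phi_simps)
    qed
  qed
  then have "component p"
    using p_nonneg p_le_1 by (force simp: component_def phi_le_iff phi_simps le_max_iff_disj)
  moreover have "\<phi> p k = 1" if k: "k \<in> topspace K" and "c < \<phi> x k" for k
  proof -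
    obtain n :: nat where "1 / (\<phi> x k - c) \<le> real n"
      using real_arch_simple by blast
    then have "\<phi> (a n) k = 1"
      using k \<open>c < \<phi> x k\<close> by (simp add: a_phi field_simps)
    then show ?thesis
      using upper_phi[OF k, of n] p_le_1[OF k] by simp
  qed
  \<comment> \<open>Each \<open>a n\<close> vanishes where \<open>z\<close> is positive, so removing
    \<open>inf p z\<close> from \<open>p\<close> leaves an upper bound. Hence \<open>inf p z\<close>
    is at most 0, which forces \<open>p = 0\<close> wherever \<open>x < c\<close>.\<close>
  moreover have "p \<le> p - inf p z"
  proof (rule least)
    fix n
    show "a n \<le> p - inf p z"
      unfolding phi_le_iff
    proof
      fix k assume k: "k \<in> topspace K"
      show "\<phi> (a n) k \<le> \<phi> (p - inf p z) k"
      proof (cases "\<phi> x k < c")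
        case True
        then show ?thesis
          using k by (simp add: a_phi phi_simps)
      next
        case False
        then show ?thesis
          using k upper_phi[OF k, of n] p_nonneg[OF k] by (simp add: phi_simps z_def)
      qed
    qed
  qed
  then have "\<phi> p k = 0" if k: "k \<in> topspace K" and "\<phi> x k < c" for k
    using that p_nonneg[OF k] by (force simp: phi_le_iff phi_simps z_def)
  ultimately have "separates_level p x c"
    by (simp add: separates_level_def)
  then show ?thesis
    using \<open>p \<in> S\<close> by blast
qed

lemma exp_approximation:
  assumes "strong_order_unit u"
    and S: "riesz_subspace S" "order_closed S" and "u \<in> S" "x \<in> S" and "0 < \<epsilon>"
  shows "\<exists>s\<in>span {p \<in> S. component p}.
    \<forall>k\<in>topspace K. \<bar>\<phi> (yosida_exp K \<phi> x) k - \<phi> s k\<bar> \<le> \<epsilon>"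
proof -
  obtain M where "\<And>k. k \<in> topspace K \<Longrightarrow> \<bar>\<phi> (yosida_exp K \<phi> x) k\<bar> \<le> M"
    using phi_bounded[OF assms(1)] by blast
  then have "0 \<le> \<phi> (yosida_exp K \<phi> x) k \<and> \<phi> (yosida_exp K \<phi> x) k \<le> M" if "k \<in> topspace K" for k
    using that by (simp add: phi_exp)
  moreover have "\<exists>p\<in>S. separates_level p (yosida_exp K \<phi> x) c" for c
    using separates_level_exp ex_separates_level[OF S \<open>u \<in> S\<close> \<open>x \<in> S\<close>] \<open>u \<in> S\<close> by blast
  ultimately obtain s where "s \<in> span {p \<in> S. component p}"
    "\<And>k. k \<in> topspace K \<Longrightarrow> \<bar>\<phi> (yosida_exp K \<phi> x) k - \<phi> s k\<bar> \<le> \<epsilon>"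
    using approximation_by_components[of "yosida_exp K \<phi> x" M S] \<open>0 < \<epsilon>\<close> by blast
  then show ?thesis
    by blast
qed

end

section \<open>The product formula\<close>

theorem theorem4p3:
  fixes u f g :: "'a::dedekind_complete_riesz_space"
    and K :: "'k topology"
    and \<phi> :: "'a \<Rightarrow> 'k \<Rightarrow> real"
    and T :: "'a \<Rightarrow> 'a"
  assumes "strong_order_unit u"
    and "yosida_representation u K \<phi>"
    and "conditional_expectation T"
    and "T u = u"
    and "cond_indep K \<phi> u T f g"
  shows "\<forall>t. moment_generating_function K \<phi> T (f + g) t =
    yosida_mult K \<phi> (moment_generating_function K \<phi> T f t) (moment_generating_function K \<phi> T g t)"
proof
  fix t
  interpret dedekind_complete_yosida_space u K \<phi>
    by unfold_locales (rule assms)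
  define S where "S h = closed_riesz_span (insert h (range T))" for h
  have indep: "cond_indep_subspaces K \<phi> u T (S f) (S g)"
    using assms(5) by (simp add: cond_indep_def S_def)
  have T: "linear T" "\<forall>x\<ge>0. 0 \<le> T x"
    using assms(3) by (auto simp: conditional_expectation_def)
  have S: "riesz_subspace (S h)" "order_closed (S h)" "u \<in> S h" "t *\<^sub>R h \<in> S h" for h
  proof -
    show "riesz_subspace (S h)" "order_closed (S h)"
      by (simp_all add: S_def closed_riesz_span)
    have sup: "insert h (range T) \<subseteq> S h"
      unfolding S_def by (rule closed_riesz_span_superset)
    then show "u \<in> S h"
      using assms(4) by (metis insert_subset rangeI subsetD)
    show "t *\<^sub>R h \<in> S h"
      using sup \<open>riesz_subspace (S h)\<close> by (simp add: riesz_subspace_def subspace_scale)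
  qed
  let ?e = "\<lambda>h. yosida_exp K \<phi> (t *\<^sub>R h)"
  note extension = multiplicative_extension[OF assms(1) T assms(4)]
  note approx = exp_approximation[OF assms(1) S]
  \<comment> \<open>The second factor stays a component, so independence supplies the base case for
    components in \<open>S f\<close>.\<close>
  have left: "T (?e f \<odot> q) = T (?e f) \<odot> T q" if "component q" "q \<in> S g" for q
    by (rule extension[where C = "{p \<in> S f. component p}"])
      (use that cond_indep_components[OF indep] approx in auto)
  \<comment> \<open>The extension acts on the first factor, so the factors are swapped;
    \<open>left\<close> is now the base case.\<close>
  have "T (?e g \<odot> ?e f) = T (?e g) \<odot> T (?e f)"
    by (rule extension[where C = "{p \<in> S g. component p}"])
      (use left approx in \<open>auto simp: mult_commute\<close>)
  then show "moment_generating_function K \<phi> T (f + g) t =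
      moment_generating_function K \<phi> T f t \<odot> moment_generating_function K \<phi> T g t"
    by (simp add: moment_generating_function_def scaleR_add_right exp_add mult_commute)
qed

end
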